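(* Let $x\ge 1$, $n\ge 3$, and let $w=(w_1,\ldots,w_n)^T$ be a positive vector. If $$w_3\le\frac{w_1}{x}\le w_2\le xw_3$$ and $$\frac{1}{x}\min\{w_3,\ldots,w_{i-1}\}\le w_i\le\frac{w_1}{x},\qquad i=4,\ldots,n,$$ then $w$ is efficient for $C_n(x)$.
   Context: For $x>0$, $C_n(x)=[a_{ij}]$ is the $n$-by-$n$ matrix with $a_{ii}=1$, $a_{ij}=x$ for $j>i$ and $a_{ij}=1/x$ for $j<i$. A vector $w$ with positive entries is efficient for a reciprocal matrix $A$ (an entrywise positive matrix with $a_{ji}=1/a_{ij}$) if, for every positive vector $v$, the entrywise inequality $\left|A-[v_i/v_j]\right|\le\left|A-[w_i/w_j]\right|$ implies $v=w$.
   Formalization: Efficiency is taken up to positive scaling: the inequality implies v = c·w for some c > 0, rather than v = w, since v = 2w gives the same matrix [v_i/v_j] and literal equality would leave no vector efficient. *)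

theory Defs
  imports "Jordan_Normal_Form.Matrix"
begin

text \<open>Vectors and matrices are indexed from 0, so entry \<open>w $ i\<close> is the
  mathematical \<open>w\<close> with subscript \<open>i + 1\<close>.\<close>

definition positive_vec :: "real vec \<Rightarrow> bool" where
  "positive_vec w \<longleftrightarrow> (\<forall>i < dim_vec w. 0 < w $ i)"

definition reciprocal_mat :: "real mat \<Rightarrow> bool" where
  "reciprocal_mat A \<longleftrightarrow> square_mat A \<and>
     (\<forall>i < dim_row A. \<forall>j < dim_row A. 0 < A $$ (i, j) \<and> A $$ (j, i) = 1 / A $$ (i, j))"

definition ratio_mat :: "real vec \<Rightarrow> real mat" where
  "ratio_mat w = mat (dim_vec w) (dim_vec w) (\<lambda>(i, j). w $ i / w $ j)"

text \<open>The order \<open>\<le>\<close> on matrices is entrywise. Since \<open>ratio_mat (c \<cdot>\<^sub>v w) = ratio_mat w\<close>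
  for \<open>c > 0\<close>, vectors can only be identified up to a positive factor: with literal
  equality \<open>v = w\<close> in the conclusion no vector of positive dimension would be efficient.\<close>

definition efficient :: "real mat \<Rightarrow> real vec \<Rightarrow> bool" where
  "efficient A w \<longleftrightarrow> reciprocal_mat A \<and> w \<in> carrier_vec (dim_row A) \<and> positive_vec w \<and>
     (\<forall>v \<in> carrier_vec (dim_row A). positive_vec v \<longrightarrow>
        map_mat abs (A - ratio_mat v) \<le> map_mat abs (A - ratio_mat w) \<longrightarrow>
        (\<exists>c > 0. v = c \<cdot>\<^sub>v w))"

definition C_mat :: "nat \<Rightarrow> real \<Rightarrow> real mat" where
  "C_mat n x = mat n n (\<lambda>(i, j). if i = j then 1 else if j > i then x else 1 / x)"

end

theory Submission
  imports Defs
begin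

text \<open>Put an arc from \<open>i\<close> to \<open>j\<close> whenever \<open>w\<^sub>i / w\<^sub>j \<ge> a\<^sub>i\<^sub>j\<close>. If \<open>v\<close> approximates \<open>A\<close> at least
  as well as \<open>w\<close>, then \<open>v\<^sub>i / w\<^sub>i \<le> v\<^sub>j / w\<^sub>j\<close> along every arc, so \<open>w\<close> is efficient as soon as the
  digraph is strongly connected. For the matrix and vector at hand (indices from 0) there are arcs
  \<open>2 \<rightarrow> 1 \<rightarrow> 0\<close>, arcs \<open>0 \<rightarrow> i\<close> for all \<open>i \<ge> 2\<close>, and from each \<open>i \<ge> 3\<close> an arc to an index in
  \<open>{2..<i}\<close> at which \<open>w\<close> is minimal; following the latter one descends from \<open>i\<close> to \<open>2\<close>.\<close>

text \<open>On an arc the ratio \<open>w $ i / w $ j\<close> is not below the entry of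
  \<open>A\<close>, so a larger ratio \<open>v $ i / v $ j\<close> would increase the error at
  \<open>(i, j)\<close>.\<close>

lemma quotient_mono_along_arc:
  assumes A: "A \<in> carrier_mat n n" and w: "w \<in> carrier_vec n" and v: "v \<in> carrier_vec n"
    and pw: "positive_vec w" and pv: "positive_vec v"
    and le: "map_mat abs (A - ratio_mat v) \<le> map_mat abs (A - ratio_mat w)"
    and ij: "i < n" "j < n" and arc: "A $$ (i, j) * w $ j \<le> w $ i"
  shows "v $ i / w $ i \<le> v $ j / w $ j"
proof -
  have pos: "0 < w $ i" "0 < w $ j" "0 < v $ i" "0 < v $ j"
    using pw pv w v ij by (auto simp: positive_vec_def)
  have "\<bar>A $$ (i, j) - v $ i / v $ j\<bar> \<le> \<bar>A $$ (i, j) - w $ i / w $ j\<bar>"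
    using le A w v ij by (auto simp: less_eq_mat_def ratio_mat_def)
  moreover have "A $$ (i, j) \<le> w $ i / w $ j"
    using arc pos by (simp add: field_simps)
  ultimately have "v $ i / v $ j \<le> w $ i / w $ j"
    by linarith
  then show ?thesis
    using pos by (simp add: field_simps)
qed

text \<open>Paths in both directions between any two indices force the quotients
  \<open>v $ i / w $ i\<close> to be all equal; their common value is the scaling factor.\<close>

lemma efficient_if_strongly_connected:
  assumes A: "reciprocal_mat A" "A \<in> carrier_mat n n"
    and w: "w \<in> carrier_vec n" "positive_vec w"
    and conn: "\<And>i j. i < n \<Longrightarrow> j < n \<Longrightarrow>
      (\<lambda>i j. i < n \<and> j < n \<and> A $$ (i, j) * w $ j \<le> w $ i)\<^sup>*\<^sup>* i j"
  shows "efficient A w"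
  unfolding efficient_def
proof (intro conjI ballI impI)
  fix v
  assume "v \<in> carrier_vec (dim_row A)" and pv: "positive_vec v"
    and le: "map_mat abs (A - ratio_mat v) \<le> map_mat abs (A - ratio_mat w)"
  then have v: "v \<in> carrier_vec n"
    using A by simp
  have mono: "v $ i / w $ i \<le> v $ j / w $ j" if "i < n" "j < n" for i j
    using conn[OF that]
  proof (induction rule: rtranclp_induct)
    case (step k l)
    then show ?case
      using quotient_mono_along_arc[OF A(2) w(1) v w(2) pv le] order_trans by blast
  qed simp
  show "\<exists>c>0. v = c \<cdot>\<^sub>v w"
  \<comment> \<open>The factor is read off at index 0, which the empty vector lacks; there any
    positive factor works.\<close>
  proof (cases "n = 0")
    case True
    then have "v = 1 \<cdot>\<^sub>v w"
      using carrier_vecD[OF v] carrier_vecD[OF w(1)] by (intro eq_vecI) simp_all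
    then show ?thesis
      by (intro exI[of _ 1] conjI) simp_all
  next
    case False
    define c where "c = v $ 0 / w $ 0"
    have "0 < c"
      using False v w pv by (auto simp: c_def positive_vec_def)
    moreover have "v $ i = c * w $ i" if "i < n" for i
    proof -
      have "v $ i / w $ i = c"
        using mono[of i 0] mono[of 0 i] that False by (simp add: c_def)
      moreover have "0 < w $ i"
        using w that by (auto simp: positive_vec_def)
      ultimately show ?thesis
        by (simp add: field_simps)
    qed
    then have "v = c \<cdot>\<^sub>v w"
      using carrier_vecD[OF v] carrier_vecD[OF w(1)] by (intro eq_vecI) simp_all
    ultimately show ?thesis
      by blast
  qed
qed (use A w in auto)

lemma reciprocal_C_mat:
  assumes "x > 0"
  shows "reciprocal_mat (C_mat n x)"
  using assms by (auto simp: reciprocal_mat_def C_mat_def)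

theorem theorem22:
  fixes x :: real and n :: nat and w :: "real vec"
  assumes "x \<ge> 1" and "n \<ge> 3"
    and "w \<in> carrier_vec n" and "positive_vec w"
    and "w $ 2 \<le> w $ 0 / x" and "w $ 0 / x \<le> w $ 1" and "w $ 1 \<le> x * w $ 2"
    and "\<forall>i \<in> {3..<n}. 1 / x * Min ((\<lambda>k. w $ k) ` {2..<i}) \<le> w $ i \<and> w $ i \<le> w $ 0 / x"
  shows "efficient (C_mat n x) w"
proof -
  have x: "x > 0"
    using assms(1) by simp
  define R where "R = (\<lambda>i j. i < n \<and> j < n \<and> C_mat n x $$ (i, j) * w $ j \<le> w $ i)"
  \<comment> \<open>Below the diagonal the entry is \<open>1 / x\<close>, so the last premise is
    exactly the arc condition.\<close>
  have R_down: "R i j" if "j < i" "i < n" "w $ j / x \<le> w $ i" for i j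
    using that by (simp add: R_def C_mat_def)
  have R_0: "R 0 i" if "2 \<le> i" "i < n" for i
  proof -
    have "w $ i \<le> w $ 0 / x"
      using that assms(5,8) by (cases "i = 2") auto
    then show ?thesis
      using that x by (simp add: R_def C_mat_def field_simps)
  qed
  have R_10: "R 1 0"
    using assms(2,6) by (intro R_down) simp_all
  have R_21: "R 2 1"
    using assms(2,7) x by (intro R_down) (simp_all add: field_simps)
  have to_2: "R\<^sup>*\<^sup>* i 2" if "2 \<le> i" "i < n" for i
    using that
  proof (induction i rule: less_induct)
    case (less i)
    show ?case
    proof (cases "i = 2")
      case False
      then have i: "3 \<le> i"
        using less.prems by simp
      then have "Min ((\<lambda>k. w $ k) ` {2..<i}) \<in> (\<lambda>k. w $ k) ` {2..<i}"
        by (intro Min_in) auto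
      then obtain k where k: "2 \<le> k" "k < i" "Min ((\<lambda>k. w $ k) ` {2..<i}) = w $ k"
        by auto
      \<comment> \<open>The lower bound on \<open>w $ i\<close>, with the minimum attained at
        \<open>k\<close>, is the condition for an arc from \<open>i\<close> down to
        \<open>k\<close>.\<close>
      have "w $ k / x \<le> w $ i"
        using assms(8)[rule_format, of i] i less.prems k(3) by simp
      then have "R i k"
        using k(2) less.prems(2) by (intro R_down)
      moreover have "R\<^sup>*\<^sup>* k 2"
        using less k by simp
      ultimately show ?thesis
        by (rule converse_rtranclp_into_rtranclp)
    qed simp
  qed
  \<comment> \<open>Index 0 serves as a hub: it is reachable from every index and reaches every
    index.\<close>
  have to_0: "R\<^sup>*\<^sup>* i 0" if "i < n" for i
  proof -
    consider "i = 0" | "i = 1" | "2 \<le> i"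
      by linarith
    then show ?thesis
    proof cases
      case 3
      then show ?thesis
        using to_2[OF 3 that] R_21 R_10 by (simp add: rtranclp.rtrancl_into_rtrancl)
    qed (use R_10 in simp_all)
  qed
  have from_0: "R\<^sup>*\<^sup>* 0 i" if "i < n" for i
  proof -
    consider "i = 0" | "i = 1" | "2 \<le> i"
      by linarith
    then show ?thesis
    proof cases
      case 2
      \<comment> \<open>An arc from 0 to 1 would need \<open>x * w $ 1 \<le> w $ 0\<close>, which
        holds only in the equality case of a hypothesis, so the path takes the detour through
        2.\<close>
      have "R 0 2"
        using assms(2) by (intro R_0) auto
      then show ?thesis
        using R_21 2 by (simp add: rtranclp.rtrancl_into_rtrancl)
    next
      case 3
      then show ?thesis
        using R_0 that by blast
    qed simp
  qed
  show ?thesis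
  proof (rule efficient_if_strongly_connected[OF reciprocal_C_mat[OF x] _ assms(3,4)])
    show "C_mat n x \<in> carrier_mat n n"
      by (simp add: C_mat_def)
    show "(\<lambda>i j. i < n \<and> j < n \<and> C_mat n x $$ (i, j) * w $ j \<le> w $ i)\<^sup>*\<^sup>* i j"
      if "i < n" "j < n" for i j
      using rtranclp_trans[OF to_0[OF that(1)] from_0[OF that(2)]] by (simp add: R_def)
  qed
qed

end
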